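(* Let $i\ge 3$ be an integer such that $n_i$ is a CA1 number, and let $p=P(n_i)$. If $n_i/n_{i-1}=q$ for a prime $q$, then $$G(n_i)<G(n_{i-1})\left(1-\left(\frac{\log q}{p\log p}\right)^2\right).$$ If $n_i/n_{i-1}=qr$ for primes $q,r$, then $$G(n_i)<G(n_{i-1})\left(1-\left(\frac{\log q}{p\log p}\right)^2\right)\left(1-\left(\frac{\log r}{p\log p}\right)^2\right).$$
   Context: For an integer $n\ge 1$ let $\sigma(n)=\sum_{d\mid n}d$ and $\rho(n)=\sigma(n)/n$; for $n\ge 2$ let $G(n)=\rho(n)/\log\log n$. For real $x>1$ and integer $k\ge1$ let $F(x,k)=\dfrac{\log\left(1+\frac{1}{x+x^2+\cdots+x^k}\right)}{\log x}$. Let $E=\{F(p,k): p\text{ prime},\ k\ge 1\text{ integer}\}$, indexed in decreasing order $\epsilon_1>\epsilon_2>\cdots$. For $\epsilon\in E$ and each integer $k\ge1$ let $x_k$ be the unique real $x>1$ with $F(x,k)=\epsilon$. For each prime $p$ put $a_p=k$ if $x_{k+1}<p\le x_k$, and $a_p=0$ if $p>x_1$; $\prod_p p^{a_p}$ is the CA (colossally abundant) number constructed from $\epsilon$. Let $n_i$ be the CA number constructed from $\epsilon_i$ ($n_1<n_2<\cdots$). $P(n)$ denotes the largest prime factor of $n\ge 2$. $n_i$ is a CA1 number if $\log n_i<P(n_i)$. *)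

theory Defs
  imports Complex_Main "HOL-Computational_Algebra.Primes"
begin

definition sigma :: "nat \<Rightarrow> nat" where
  "sigma n = (\<Sum>d | d dvd n. d)"

definition rho :: "nat \<Rightarrow> real" where
  "rho n = real (sigma n) / real n"

definition G :: "nat \<Rightarrow> real" where
  "G n = rho n / ln (ln (real n))"

definition F :: "real \<Rightarrow> nat \<Rightarrow> real" where
  "F x k = ln (1 + 1 / (\<Sum>j=1..k. x ^ j)) / ln x"

definition E :: "real set" where
  "E = {F (real p) k | p k. prime p \<and> k \<ge> 1}"

text \<open>
  The indexing is one-based, and \<open>eps i\<close> is meaningful for \<open>i \<ge> 1\<close> only: it is the element
  of \<open>E\<close> with exactly \<open>i\<close> elements of \<open>E\<close> greater than or equal to it. A positive
  cardinality entails that this set of elements is finite.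
\<close>

definition eps :: "nat \<Rightarrow> real" where
  "eps i = (THE e. e \<in> E \<and> card {e' \<in> E. e \<le> e'} = i)"

definition threshold :: "real \<Rightarrow> nat \<Rightarrow> real" where
  "threshold e k = (THE x. x > 1 \<and> F x k = e)"

definition ca_exponent :: "real \<Rightarrow> nat \<Rightarrow> nat" where
  "ca_exponent e p =
     (if real p > threshold e 1 then 0
      else (THE k. k \<ge> 1 \<and> threshold e (k + 1) < real p \<and> real p \<le> threshold e k))"

text \<open>
  The product over all primes is restricted to the finitely many primes up to \<open>threshold e 1\<close>,
  beyond which all exponents vanish.
\<close>

definition ca_from :: "real \<Rightarrow> nat" where
  "ca_from e = (\<Prod>p | prime p \<and> real p \<le> threshold e 1. p ^ ca_exponent e p)"

definition ca_number :: "nat \<Rightarrow> nat" where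
  "ca_number i = ca_from (eps i)"

definition largest_prime_factor :: "nat \<Rightarrow> nat" where
  "largest_prime_factor n = Max (prime_factors n)"

definition CA1 :: "nat \<Rightarrow> bool" where
  "CA1 i \<longleftrightarrow> ln (real (ca_number i)) < real (largest_prime_factor (ca_number i))"

end

theory Submission
  imports Defs
begin

text \<open>
  Let \<open>n = n\<^sub>i\<close>, \<open>m = n\<^sub>i\<^sub>-\<^sub>1\<close>, \<open>L = log (n/m)\<close> and \<open>u = L / (p log p)\<close>. Passing from \<open>m\<close> to \<open>n\<close>
  multiplies \<open>rho\<close> by \<open>q powr F(q,k)\<close> for each prime \<open>q\<close> gained, where \<open>F(q,k) < \<epsilon>\<^sub>i\<^sub>-\<^sub>1\<close> because the
  step is not taken at \<open>\<epsilon>\<^sub>i\<^sub>-\<^sub>1\<close>; hence \<open>F(q,k) \<le> \<epsilon>\<^sub>i \<le> F(p,1) < 1/(p log p)\<close> and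
  \<open>rho n \<le> rho m * exp u\<close>. From \<open>log n < p\<close> one gets
  \<open>log log m / log log n \<le> 1 - u - u\<^sup>2 log p / 2\<close>, and \<open>exp u * (1 - u) \<le> 1 - u\<^sup>2/2\<close> together with
  \<open>log p > 1\<close> yields \<open>G n < G m * (1 - u\<^sup>2)\<close>. For two primes, \<open>1 - (s+t)\<^sup>2 \<le> (1 - s\<^sup>2) * (1 - t\<^sup>2)\<close>.
\<close>

section \<open>Elementary inequalities\<close>

text \<open>The difference of the two sides vanishes at 0 and has derivative
  \<open>- y^2 / (1 - y)\<close>. The quadratic term is kept because the gain sought in the end is
  of second order: the linear terms cancel against those of \<open>exp u\<close>.\<close>

lemma ln_one_minus_le_quadratic:
  fixes x :: real
  assumes "0 \<le> x" "x < 1"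
  shows "ln (1 - x) \<le> - x - x\<^sup>2 / 2"
proof -
  let ?f = "\<lambda>x::real. ln (1 - x) + x + x\<^sup>2 / 2"
  have "?f x \<le> ?f 0"
  proof (rule DERIV_nonpos_imp_nonincreasing[OF assms(1)])
    fix y assume y: "0 \<le> y" "y \<le> x"
    have "(?f has_real_derivative (- 1 / (1 - y) + 1 + y)) (at y)"
      using y assms by (auto intro!: derivative_eq_intros)
    moreover have "- 1 / (1 - y) + 1 + y \<le> 0"
      using y assms by (simp add: field_simps)
    ultimately show "\<exists>d. (?f has_real_derivative d) (at y) \<and> d \<le> 0"
      by blast
  qed
  then show ?thesis by simp
qed

lemma exp_mult_one_minus_le:
  fixes u :: real
  assumes "0 \<le> u"
  shows "exp u * (1 - u) \<le> 1 - u\<^sup>2 / 2"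
proof -
  let ?f = "\<lambda>u::real. exp u * (1 - u) + u\<^sup>2 / 2"
  have "?f u \<le> ?f 0"
  proof (rule DERIV_nonpos_imp_nonincreasing[OF assms])
    fix y :: real assume y: "0 \<le> y" "y \<le> u"
    have "(?f has_real_derivative (y * (1 - exp y))) (at y)"
      by (auto intro!: derivative_eq_intros simp: algebra_simps)
    moreover have "y * (1 - exp y) \<le> 0"
      using y by (simp add: mult_nonneg_nonpos)
    ultimately show "\<exists>d. (?f has_real_derivative d) (at y) \<and> d \<le> 0"
      by blast
  qed
  then show ?thesis by simp
qed

text \<open>It suffices that \<open>exp 1 < 3\<close>. From \<open>exp (-1/6) >= 5/6\<close> follows
  \<open>exp 1 <= (6/5)^6 < 3\<close>; 6 is the least \<open>n\<close> with
  \<open>(n / (n - 1))^n < 3\<close>.\<close>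

lemma ln_gt_1_if_ge_3:
  fixes x :: real
  assumes "3 \<le> x"
  shows "1 < ln x"
proof -
  have "exp (1/6::real) \<le> 6/5"
    using exp_ge_add_one_self[of "-1/6::real"] by (simp add: exp_minus field_simps)
  then have "exp (1/6::real) ^ 6 \<le> (6/5) ^ 6"
    by (intro power_mono) auto
  also have "exp (1/6::real) ^ 6 = exp 1"
    by (simp flip: exp_of_nat_mult)
  finally have "exp 1 < x"
    using assms by (simp add: power_divide)
  then show ?thesis
    using assms by (metis exp_gt_zero less_trans ln_exp ln_less_cancel_iff)
qed

text \<open>Applied with \<open>A = ln m\<close>, \<open>B = ln n\<close>, \<open>P = p\<close>.
  Since \<open>A = B * (1 - L / B)\<close> and \<open>B < P\<close>, one may replace
  \<open>B\<close> by \<open>P\<close> both in \<open>L / B\<close> and in the denominator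
  \<open>ln B\<close>. The factor \<open>ln P\<close> in the quadratic term arises from
  \<open>L / P = u * ln P\<close>, whose square loses one factor to the denominator.\<close>

lemma ln_ln_ratio_bound:
  fixes A B P :: real
  assumes "1 < A" "A < B" "B < P"
  defines "u \<equiv> (B - A) / (P * ln P)"
  shows "ln A / ln B \<le> 1 - u - u\<^sup>2 * ln P / 2"
proof -
  define L where "L = B - A"
  have L: "0 < L" "L < B"
    using assms by (auto simp: L_def)
  have lnB: "0 < ln B" "ln B < ln P"
    using assms by auto
  have "ln A = ln (B * (1 - L / B))"
    using assms by (simp add: L_def field_simps)
  also have "\<dots> = ln B + ln (1 - L / B)"
    using L assms by (subst ln_mult_pos) auto
  also have "ln (1 - L / B) \<le> - (L / B) - (L / B)\<^sup>2 / 2"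
    using L assms by (intro ln_one_minus_le_quadratic) auto
  also have "\<dots> \<le> - (L / P) - (L / P)\<^sup>2 / 2"
  proof -
    have "L / P \<le> L / B"
      using L assms by (intro divide_left_mono) auto
    moreover from this have "(L / P)\<^sup>2 \<le> (L / B)\<^sup>2"
      using L assms by (intro power_mono) auto
    ultimately show ?thesis by linarith
  qed
  finally have "ln A \<le> ln B - (L / P + (L / P)\<^sup>2 / 2)"
    by simp
  then have "ln A / ln B \<le> (ln B - (L / P + (L / P)\<^sup>2 / 2)) / ln B"
    using lnB by (intro divide_right_mono) auto
  also have "\<dots> = 1 - (L / P + (L / P)\<^sup>2 / 2) / ln B"
    using lnB by (simp add: diff_divide_distrib)
  also have "\<dots> \<le> 1 - (L / P + (L / P)\<^sup>2 / 2) / ln P"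
    using lnB L assms by (intro diff_left_mono divide_left_mono) (auto intro!: add_nonneg_nonneg)
  also have "\<dots> = 1 - u - u\<^sup>2 * ln P / 2"
    using lnB assms by (simp add: u_def L_def field_simps power2_eq_square)
  finally show ?thesis .
qed

text \<open>Two second-order gains add up: \<open>u^2 / 2\<close> from
  \<open>exp u * (1 - u)\<close>, and \<open>u^2 * ln P / 2\<close> from the logarithms. The second
  exceeds \<open>u^2 / 2\<close> because \<open>ln P > 1\<close>, which also gives
  strictness.\<close>

lemma exp_times_ln_ln_ratio_less:
  fixes A B P :: real
  assumes "1 < A" "A < B" "B < P" "1 < ln P"
  defines "u \<equiv> (B - A) / (P * ln P)"
  shows "exp u * (ln A / ln B) < 1 - u\<^sup>2"
proof -
  have u: "0 < u"
    using assms by (auto simp: u_def)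
  have "exp u * (ln A / ln B) \<le> exp u * (1 - u - u\<^sup>2 * ln P / 2)"
    using ln_ln_ratio_bound[OF assms(1-3)] unfolding u_def by (intro mult_left_mono) auto
  also have "\<dots> = exp u * (1 - u) - exp u * (u\<^sup>2 * ln P / 2)"
    by (simp add: algebra_simps)
  also have "\<dots> \<le> (1 - u\<^sup>2 / 2) - 1 * (u\<^sup>2 * ln P / 2)"
    using u assms by (intro diff_mono exp_mult_one_minus_le mult_right_mono) auto
  also have "\<dots> < 1 - u\<^sup>2"
  proof -
    have "u\<^sup>2 * 1 < u\<^sup>2 * ln P"
      using u assms(4) by (intro mult_strict_left_mono) auto
    then show ?thesis by linarith
  qed
  finally show ?thesis .
qed

section \<open>The function F\<close>

text \<open>The first bound makes \<open>F x k\<close> small for large \<open>x\<close>, the second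
  for large \<open>k\<close>.\<close>

lemma geometric_sum_ge:
  fixes x :: real
  assumes "1 < x" "1 \<le> k"
  shows "x \<le> (\<Sum>j=1..k. x ^ j)" "real k \<le> (\<Sum>j=1..k. x ^ j)"
proof -
  have "x ^ 1 \<le> (\<Sum>j=1..k. x ^ j)"
    using assms by (intro member_le_sum) auto
  then show "x \<le> (\<Sum>j=1..k. x ^ j)" by simp
  have "(\<Sum>j=1..k. 1) \<le> (\<Sum>j=1..k. x ^ j)"
    using assms by (intro sum_mono one_le_power) auto
  then show "real k \<le> (\<Sum>j=1..k. x ^ j)" by simp
qed

lemma ln_one_plus_inverse_pos:
  fixes s :: real
  shows "0 < s \<Longrightarrow> 0 < ln (1 + 1 / s)"
  by (intro ln_gt_zero) simp

lemma ln_one_plus_inverse_strict_antimono: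
  fixes s t :: real
  assumes "0 < s" "s < t"
  shows "ln (1 + 1 / t) < ln (1 + 1 / s)"
proof -
  have "0 < 1 / t" "1 / t < 1 / s"
    using assms by (auto intro: divide_strict_left_mono)
  then have "0 < 1 + 1 / t" "1 + 1 / t < 1 + 1 / s" by linarith+
  then show ?thesis by simp
qed

lemma ln_one_plus_inverse_antimono:
  fixes s t :: real
  shows "0 < s \<Longrightarrow> s \<le> t \<Longrightarrow> ln (1 + 1 / t) \<le> ln (1 + 1 / s)"
  using ln_one_plus_inverse_strict_antimono[of s t] by (cases "s = t") auto

lemma F_pos:
  assumes "1 < x" "1 \<le> k"
  shows "0 < F x k"
  using geometric_sum_ge(1)[OF assms] assms unfolding F_def
  by (intro divide_pos_pos ln_one_plus_inverse_pos) auto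

lemma F_strict_antimono_exponent:
  assumes "1 < x" "1 \<le> k" "k < l"
  shows "F x l < F x k"
proof -
  have "(\<Sum>j=1..k. x ^ j) < (\<Sum>j=1..l. x ^ j)"
    using assms by (intro sum_strict_mono2[where b = l]) auto
  moreover have "0 < (\<Sum>j=1..k. x ^ j)"
    using geometric_sum_ge(1)[OF assms(1,2)] assms by linarith
  ultimately show ?thesis
    using assms unfolding F_def
    by (intro divide_strict_right_mono ln_one_plus_inverse_strict_antimono) auto
qed

lemma F_antimono_exponent:
  assumes "1 < x" "1 \<le> k" "k \<le> l"
  shows "F x l \<le> F x k"
  using F_strict_antimono_exponent[of x k l] assms by (cases "k = l") auto

text \<open>The numerator stays positive and does not increase; strictness comes from the
  denominator \<open>ln x\<close>.\<close>

lemma F_strict_antimono: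
  assumes "1 < x" "x < y" "1 \<le> k"
  shows "F y k < F x k"
proof -
  have Sx: "0 < (\<Sum>j=1..k. x ^ j)"
    using geometric_sum_ge(1)[OF assms(1,3)] assms by linarith
  moreover have "(\<Sum>j=1..k. x ^ j) \<le> (\<Sum>j=1..k. y ^ j)"
    using assms by (intro sum_mono power_mono) auto
  ultimately have "ln (1 + 1 / (\<Sum>j=1..k. y ^ j)) \<le> ln (1 + 1 / (\<Sum>j=1..k. x ^ j))"
    by (intro ln_one_plus_inverse_antimono)
  moreover have "0 < ln (1 + 1 / (\<Sum>j=1..k. y ^ j))"
    using geometric_sum_ge(1)[of y k] assms by (intro ln_one_plus_inverse_pos) simp
  ultimately show ?thesis
    using assms unfolding F_def by (intro frac_less2) auto
qed

lemma F_antimono: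
  assumes "1 < x" "x \<le> y" "1 \<le> k"
  shows "F y k \<le> F x k"
  using F_strict_antimono[of x y k] assms by (cases "x = y") auto

lemma F_le:
  assumes "1 < x" "1 \<le> k"
  shows "F x k \<le> 1 / (x * ln x)" "F x k \<le> 1 / (real k * ln x)"
proof -
  let ?S = "\<Sum>j=1..k. x ^ j"
  note S = geometric_sum_ge[OF assms]
  have "ln (1 + 1 / ?S) \<le> 1 / ?S"
    using S assms by (intro ln_add_one_self_le_self) auto
  moreover have "1 / ?S \<le> 1 / x" "1 / ?S \<le> 1 / real k"
    using S assms by (intro divide_left_mono; simp)+
  ultimately have "ln (1 + 1 / ?S) \<le> 1 / x" "ln (1 + 1 / ?S) \<le> 1 / real k"
    by auto
  then have "F x k \<le> 1 / x / ln x" "F x k \<le> 1 / real k / ln x"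
    unfolding F_def using assms by (intro divide_right_mono; simp)+
  then show "F x k \<le> 1 / (x * ln x)" "F x k \<le> 1 / (real k * ln x)"
    by simp_all
qed

lemma continuous_on_F:
  assumes "1 < a" "1 \<le> k"
  shows "continuous_on {a..b} (\<lambda>x. F x k)"
proof -
  have "0 < (\<Sum>j=1..k. x ^ j)" if "a \<le> x" for x
    using geometric_sum_ge(1)[of x k] assms that by linarith
  then have "1 + 1 / (\<Sum>j=1..k. x ^ j) \<noteq> 0" "(\<Sum>j=1..k. x ^ j) \<noteq> 0" if "a \<le> x" for x
    using that by (smt (verit) divide_pos_pos)+
  then show ?thesis
    using assms unfolding F_def by (intro continuous_intros) auto
qed

text \<open>Gives the \<open>THE\<close> in \<open>threshold\<close> its meaning: existence by the
  intermediate value theorem between explicit points \<open>a\<close> and \<open>b\<close>,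
  uniqueness by strict monotonicity.\<close>

lemma ex1_F_eq:
  assumes "0 < e" "1 \<le> k"
  shows "\<exists>!x. 1 < x \<and> F x k = e"
proof -
  \<comment> \<open>For \<open>1 < a <= 2\<close> the numerator of \<open>F a k\<close> is at least
    \<open>c\<close>, so \<open>ln a <= c / e\<close> makes \<open>F a k\<close> at least
    \<open>e\<close>.\<close>
  define c where "c = ln (1 + 1 / (\<Sum>j=1..k. (2::real) ^ j))"
  have c: "0 < c"
    using geometric_sum_ge(1)[of 2 k] assms unfolding c_def
    by (intro ln_one_plus_inverse_pos) simp
  define a where "a = exp (min (ln 2) (c / e))"
  have a: "1 < a" "a \<le> 2" "ln a \<le> c / e"
  proof -
    show "1 < a" using c assms by (simp add: a_def)
    have "a \<le> exp (ln 2)" unfolding a_def by (subst exp_le_cancel_iff) simp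
    then show "a \<le> 2" by simp
    show "ln a \<le> c / e" by (simp add: a_def)
  qed
  have "c / ln a \<le> F a k"
  proof -
    have S: "0 < (\<Sum>j=1..k. a ^ j)"
      using geometric_sum_ge(1)[of a k] a assms by linarith
    moreover have "(\<Sum>j=1..k. a ^ j) \<le> (\<Sum>j=1..k. 2 ^ j)"
      using a by (intro sum_mono power_mono) auto
    ultimately have "c \<le> ln (1 + 1 / (\<Sum>j=1..k. a ^ j))"
      unfolding c_def by (intro ln_one_plus_inverse_antimono)
    then show ?thesis
      unfolding F_def using a by (intro divide_right_mono) auto
  qed
  moreover have "e \<le> c / ln a"
    using a c assms by (simp add: field_simps)
  ultimately have Fa: "e \<le> F a k" by linarith
  \<comment> \<open>The lower bound 3 gives \<open>ln b > 1\<close>, hence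
    \<open>F b k <= 1 / (b * ln b) <= 1 / b <= e\<close>.\<close>
  define b where "b = max 3 (1 / e)"
  have b: "3 \<le> b" "1 / e \<le> b" by (auto simp: b_def)
  have "F b k \<le> 1 / (b * ln b)"
    using b assms by (intro F_le) auto
  also have "\<dots> \<le> 1 / (b * 1)"
    using b ln_gt_1_if_ge_3[OF b(1)] by (intro divide_left_mono mult_left_mono) auto
  also have "\<dots> \<le> e"
    using b assms by (simp add: field_simps)
  finally have Fb: "F b k \<le> e" .
  have "\<exists>x\<ge>a. x \<le> b \<and> F x k = e"
    using Fa Fb a b assms by (intro IVT2' continuous_on_F) auto
  then obtain x where x: "1 < x" "F x k = e"
    using a(1) less_le_trans by blast
  show ?thesis
  proof (rule ex1I[of _ x])
    fix y assume y: "1 < y \<and> F y k = e"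
    then show "y = x"
      using F_strict_antimono[of x y k] F_strict_antimono[of y x k] x assms
      by (cases x y rule: linorder_cases) auto
  qed (use x in auto)
qed

text \<open>By monotonicity of \<open>F\<close> in \<open>x\<close>. This eliminates thresholds:
  comparing a prime with \<open>threshold e k\<close> becomes comparing \<open>e\<close> with a
  value of \<open>F\<close>.\<close>

lemma le_threshold_iff:
  assumes "0 < e" "1 \<le> k" "1 < x"
  shows "x \<le> threshold e k \<longleftrightarrow> e \<le> F x k"
proof -
  have t: "1 < threshold e k" "F (threshold e k) k = e"
    using theI'[OF ex1_F_eq[OF assms(1,2)]] by (auto simp: threshold_def)
  show ?thesis
    using F_antimono[of x "threshold e k" k] F_strict_antimono[of "threshold e k" x k] t assms
    by (cases "x \<le> threshold e k") auto
qed

section \<open>Exponents of the constructed numbers\<close>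

text \<open>For fixed \<open>p\<close>, \<open>F p k\<close> decreases to 0 in \<open>k\<close>, so
  there is a first \<open>j\<close> with \<open>F p j < e\<close>. The hypothesis at exponent 1
  excludes \<open>j = 1\<close>, and \<open>j - 1\<close> is the only value that the
  \<open>THE\<close> in \<open>ca_exponent\<close> can denote.\<close>

lemma ca_exponent_spec:
  assumes "0 < e" "1 < real p" "e \<le> F (real p) 1"
  defines "k \<equiv> ca_exponent e p"
  shows "1 \<le> k" "F (real p) (k + 1) < e"
proof -
  \<comment> \<open>Chosen so that the bound \<open>1 / (K * ln p)\<close> on \<open>F p K\<close>
    falls below \<open>e\<close>; this ensures that the \<open>LEAST\<close> defining
    \<open>j\<close> exists.\<close>
  define K where "K = nat \<lceil>1 / (e * ln (real p))\<rceil> + 1"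
  have lnp: "0 < ln (real p)" using assms by simp
  have "1 / (e * ln (real p)) < real K"
    unfolding K_def by linarith
  then have "1 < real K * (e * ln (real p))"
    using lnp assms(1) by (subst (asm) pos_divide_less_eq) auto
  moreover have "0 < real K" by (simp add: K_def)
  ultimately have "1 / (real K * ln (real p)) < e"
    using lnp by (subst pos_divide_less_eq) (auto simp: mult_ac)
  moreover have "F (real p) K \<le> 1 / (real K * ln (real p))"
    using assms by (intro F_le) (auto simp: K_def)
  ultimately have K: "F (real p) K < e" by linarith
  define j where "j = (LEAST j. 1 \<le> j \<and> F (real p) j < e)"
  have "1 \<le> K" by (simp add: K_def)
  with K have j: "1 \<le> j" "F (real p) j < e"
    unfolding j_def by (metis (mono_tags, lifting) LeastI)+
  have j_least: "e \<le> F (real p) l" if "1 \<le> l" "l < j" for l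
    using not_less_Least[of l "\<lambda>j. 1 \<le> j \<and> F (real p) j < e"] that by (force simp: j_def)
  have "j \<noteq> 1" using j assms by auto
  with j have j2: "2 \<le> j" by simp
  let ?P = "\<lambda>k. 1 \<le> k \<and> threshold e (k + 1) < real p \<and> real p \<le> threshold e k"
  have P_iff: "?P k \<longleftrightarrow> 1 \<le> k \<and> F (real p) (k + 1) < e \<and> e \<le> F (real p) k" for k
    using le_threshold_iff[of e "k+1" "real p"] le_threshold_iff[of e k "real p"] assms
    by (auto simp: not_le[symmetric])
  have "\<exists>!k. ?P k"
  proof (rule ex1I[of _ "j - 1"])
    show "?P (j - 1)" unfolding P_iff using j j2 j_least[of "j - 1"] by auto
  next
    fix k assume "?P k"
    then have k: "1 \<le> k" "F (real p) (k + 1) < e" "e \<le> F (real p) k"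
      unfolding P_iff by auto
    have "\<not> k + 1 < j" using j_least[of "k + 1"] k by auto
    moreover have "\<not> j \<le> k"
      using F_antimono_exponent[of "real p" j k] j k assms by auto
    ultimately show "k = j - 1" by simp
  qed
  moreover have "k = (THE k. ?P k)"
    using le_threshold_iff[of e 1 "real p"] assms unfolding k_def ca_exponent_def by auto
  ultimately have "?P k"
    using theI'[of ?P] by simp
  then show "1 \<le> k" "F (real p) (k + 1) < e"
    unfolding P_iff by auto
qed

lemma prime_gt_1_real: "prime p \<Longrightarrow> 1 < real p"
  using prime_gt_1_nat[of p] by simp

lemma finite_primes_le_real: "finite {p::nat. prime p \<and> real p \<le> x}"
  by (rule finite_subset[of _ "{..nat \<lfloor>x\<rfloor>}"]) (auto simp: le_nat_floor)

lemma ca_from_pos: "0 < ca_from e"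
  unfolding ca_from_def by (intro prod_pos) (auto dest: prime_gt_0_nat)

lemma multiplicity_ca_from:
  assumes "prime q"
  shows "multiplicity q (ca_from e) = (if real q \<le> threshold e 1 then ca_exponent e q else 0)"
  unfolding ca_from_def using assms
  by (subst multiplicity_prod_prime_powers) (auto simp: finite_primes_le_real)

text \<open>The exponent taken at \<open>e\<close> is maximal. If \<open>e <= F q 1\<close>, the
  claim is known for the exponent after it and extends by monotonicity in \<open>k\<close>;
  otherwise \<open>F q 1 < e\<close> suffices.\<close>

lemma F_less_if_gt_multiplicity:
  assumes "0 < e" "prime q" "multiplicity q (ca_from e) < k"
  shows "F (real q) k < e"
proof (cases "e \<le> F (real q) 1")
  case True
  then have "multiplicity q (ca_from e) = ca_exponent e q"
    using le_threshold_iff[of e 1 "real q"] assms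
    by (simp add: multiplicity_ca_from prime_gt_Suc_0_nat)
  then have "F (real q) k \<le> F (real q) (ca_exponent e q + 1)"
    using assms by (intro F_antimono_exponent prime_gt_1_real) auto
  also have "\<dots> < e"
    using True assms by (intro ca_exponent_spec prime_gt_1_real)
  finally show ?thesis .
next
  case False
  moreover have "F (real q) k \<le> F (real q) 1"
    using assms by (intro F_antimono_exponent prime_gt_1_real) auto
  ultimately show ?thesis by linarith
qed

text \<open>Primes up to the first threshold get exponent at least 1, all others 0. Applied below to
  3 and to the largest prime factor.\<close>

lemma dvd_ca_from_iff:
  assumes "0 < e" "prime q"
  shows "q dvd ca_from e \<longleftrightarrow> e \<le> F (real q) 1"
proof -
  have "q dvd ca_from e \<longleftrightarrow> 0 < multiplicity q (ca_from e)"
    using assms ca_from_pos[of e] by (simp add: prime_multiplicity_gt_zero_iff)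
  also have "\<dots> \<longleftrightarrow> e \<le> F (real q) 1"
    using le_threshold_iff[of e 1 "real q"] ca_exponent_spec(1)[of e q] assms
    by (auto simp: multiplicity_ca_from prime_gt_Suc_0_nat)
  finally show ?thesis .
qed

section \<open>The enumeration of E\<close>

text \<open>Existence descends from the maximum, each time to the largest element below the current
  one: finite upper sets provide the maxima, infinity of \<open>A\<close> the elements to go on
  with. For uniqueness, upper sets of distinct elements are properly nested. This makes the
  \<open>THE\<close> in \<open>eps\<close> meaningful.\<close>

lemma ex1_card_upper_set:
  fixes A :: "'a::linorder set"
  assumes "infinite A" and fin: "\<And>a. a \<in> A \<Longrightarrow> finite {x \<in> A. a \<le> x}" and "1 \<le> i"
  shows "\<exists>!a. a \<in> A \<and> card {x \<in> A. a \<le> x} = i"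
proof -
  have "\<exists>a. a \<in> A \<and> card {x \<in> A. a \<le> x} = i"
    using \<open>1 \<le> i\<close>
  proof (induction i rule: dec_induct)
    case base
    obtain a where a: "a \<in> A" using assms(1) by (metis finite.emptyI ex_in_conv)
    define M where "M = Max {x \<in> A. a \<le> x}"
    have M: "M \<in> {x \<in> A. a \<le> x}"
      unfolding M_def using a fin by (intro Max_in) auto
    have "x \<le> M" if "x \<in> A" for x
      using that M fin[OF a] unfolding M_def by (cases "a \<le> x") auto
    then have "{x \<in> A. M \<le> x} = {M}" using M by (auto intro: antisym)
    then show ?case using M by (intro exI[of _ M]) auto
  next
    case (step n)
    then obtain b where b: "b \<in> A" "card {x \<in> A. b \<le> x} = n" by blast
    have "infinite (A - {x \<in> A. b \<le> x})"
      using assms(1) fin[OF b(1)] by (rule Diff_infinite_finite[rotated])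
    then obtain a where a: "a \<in> A" "a < b"
      by (metis (no_types, lifting) DiffD1 DiffD2 finite.emptyI ex_in_conv mem_Collect_eq not_le)
    \<comment> \<open>The bound \<open>a\<close> only serves to make the set finite:
      \<open>M\<close> is the largest element of \<open>A\<close> below \<open>b\<close>, so its
      upper set has exactly one element more.\<close>
    define M where "M = Max {x \<in> A. a \<le> x \<and> x < b}"
    have fin': "finite {x \<in> A. a \<le> x \<and> x < b}"
      by (rule finite_subset[OF _ fin[OF a(1)]]) auto
    have M: "M \<in> {x \<in> A. a \<le> x \<and> x < b}"
      unfolding M_def using a fin' by (intro Max_in) auto
    have "x \<le> M" if "x \<in> A" "x < b" for x
      using that M fin' unfolding M_def by (cases "a \<le> x") auto
    then have "{x \<in> A. M \<le> x} = insert M {x \<in> A. b \<le> x}"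
      using M by (auto intro: antisym simp: not_le[symmetric])
    moreover have "M \<notin> {x \<in> A. b \<le> x}" using M by auto
    ultimately have "card {x \<in> A. M \<le> x} = Suc n"
      using b(2) fin[OF b(1)] by (metis card_insert_disjoint)
    then show ?case using M by blast
  qed
  moreover have "a = b" if "a \<in> A" "b \<in> A" "card {x \<in> A. a \<le> x} = card {x \<in> A. b \<le> x}" for a b
  proof -
    have "\<not> c < d" if "c \<in> A" "d \<in> A" "card {x \<in> A. c \<le> x} = card {x \<in> A. d \<le> x}" for c d
    proof
      assume "c < d"
      then have "c \<in> {x \<in> A. c \<le> x}" "c \<notin> {x \<in> A. d \<le> x}"
          "{x \<in> A. d \<le> x} \<subseteq> {x \<in> A. c \<le> x}"
        using that by auto
      then have "{x \<in> A. d \<le> x} \<subset> {x \<in> A. c \<le> x}" by blast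
      then have "card {x \<in> A. d \<le> x} < card {x \<in> A. c \<le> x}"
        by (rule psubset_card_mono[OF fin[OF that(1)]])
      then show False using that(3) by simp
    qed
    from this[of a b] this[of b a] show ?thesis using that by auto
  qed
  ultimately show ?thesis by blast
qed

lemma E_pos: "e \<in> E \<Longrightarrow> 0 < e"
  by (auto simp: E_def intro!: F_pos prime_gt_1_real)

text \<open>As \<open>ln p >= ln 2\<close>, the two bounds in \<open>F_le\<close> turn
  \<open>e <= F p k\<close> into \<open>p, k <= 1 / (e * ln 2)\<close>, which leaves finitely many
  pairs.\<close>

lemma finite_upper_E:
  assumes "0 < e"
  shows "finite {x \<in> E. e \<le> x}"
proof -
  define N where "N = nat \<lfloor>1 / (e * ln 2)\<rfloor>"
  have "{x \<in> E. e \<le> x} \<subseteq> (\<lambda>(p, k). F (real p) k) ` ({..N} \<times> {..N})"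
  proof
    fix x assume "x \<in> {x \<in> E. e \<le> x}"
    then obtain p k where pk: "x = F (real p) k" "prime p" "1 \<le> k" "e \<le> F (real p) k"
      by (auto simp: E_def)
    have p: "2 \<le> real p" using prime_ge_2_nat[OF pk(2)] by simp
    have bound: "y \<le> 1 / (e * ln 2)" if "e \<le> 1 / (y * ln (real p))" "0 < y" for y
    proof -
      have "e * (y * ln 2) \<le> e * (y * ln (real p))"
        using p that assms by (intro mult_left_mono) auto
      also have "\<dots> \<le> 1"
        using that p by (simp add: field_simps)
      finally show ?thesis using assms by (simp add: field_simps)
    qed
    have "e \<le> 1 / (real p * ln (real p))" "e \<le> 1 / (real k * ln (real p))"
      using F_le[of "real p" k] pk p by linarith+
    then have "real p \<le> 1 / (e * ln 2)" "real k \<le> 1 / (e * ln 2)"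
      using bound p pk by auto
    then have "p \<le> N" "k \<le> N" by (auto simp: N_def le_nat_floor)
    then show "x \<in> (\<lambda>(p, k). F (real p) k) ` ({..N} \<times> {..N})"
      using pk by force
  qed
  then show ?thesis by (rule finite_subset) auto
qed

lemma infinite_E: "infinite E"
proof
  assume "finite E"
  then have "finite ((\<lambda>p. F (real p) 1) ` {p::nat. prime p})"
    by (rule rev_finite_subset) (auto simp: E_def)
  moreover have "inj_on (\<lambda>p. F (real p) 1) {p::nat. prime p}"
  proof (rule linorder_inj_onI)
    fix p q :: nat assume "p < q" "p \<in> {p. prime p}"
    then show "F (real p) 1 \<noteq> F (real q) 1"
      using F_strict_antimono[of "real p" "real q" 1] by (auto simp: prime_gt_Suc_0_nat)
  qed auto
  ultimately show False
    using primes_infinite finite_imageD by blast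
qed

lemma eps_spec:
  assumes "1 \<le> i"
  shows "eps i \<in> E" "card {x \<in> E. eps i \<le> x} = i"
proof -
  have "\<exists>!e. e \<in> E \<and> card {x \<in> E. e \<le> x} = i"
    using assms by (intro ex1_card_upper_set infinite_E finite_upper_E E_pos)
  from theI'[OF this] show "eps i \<in> E" "card {x \<in> E. eps i \<le> x} = i"
    by (auto simp: eps_def)
qed

text \<open>If \<open>f\<close> lay strictly between \<open>eps i\<close> and
  \<open>eps (i - 1)\<close>, the number of elements of \<open>E\<close> at or above
  \<open>f\<close> would lie strictly between \<open>i - 1\<close> and \<open>i\<close>.\<close>

lemma le_eps_if_less_eps_pred:
  assumes "2 \<le> i" "f \<in> E" "f < eps (i - 1)"
  shows "f \<le> eps i"
proof (rule ccontr)
  assume "\<not> f \<le> eps i"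
  then have lt: "eps i < f" by simp
  have e: "eps i \<in> E" "card {x \<in> E. eps i \<le> x} = i"
      "card {x \<in> E. eps (i - 1) \<le> x} = i - 1"
    using assms(1) by (auto intro: eps_spec)
  have "f \<in> {x \<in> E. f \<le> x}" "f \<notin> {x \<in> E. eps (i - 1) \<le> x}"
    using assms by auto
  moreover have "{x \<in> E. eps (i - 1) \<le> x} \<subseteq> {x \<in> E. f \<le> x}"
    using assms by auto
  ultimately have "{x \<in> E. eps (i - 1) \<le> x} \<subset> {x \<in> E. f \<le> x}"
    by blast
  then have "card {x \<in> E. eps (i - 1) \<le> x} < card {x \<in> E. f \<le> x}"
    by (rule psubset_card_mono[OF finite_upper_E[OF E_pos[OF assms(2)]]])
  moreover have "eps i \<in> {x \<in> E. eps i \<le> x}" "eps i \<notin> {x \<in> E. f \<le> x}"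
      "{x \<in> E. f \<le> x} \<subseteq> {x \<in> E. eps i \<le> x}"
    using lt e(1) assms by auto
  then have "{x \<in> E. f \<le> x} \<subset> {x \<in> E. eps i \<le> x}"
    by blast
  then have "card {x \<in> E. f \<le> x} < card {x \<in> E. eps i \<le> x}"
    by (rule psubset_card_mono[OF finite_upper_E[OF E_pos[OF e(1)]]])
  ultimately show False using e by linarith
qed

text \<open>Compares \<open>ln (7/6) / ln 2\<close> with \<open>ln (4/3) / ln 3\<close> through the
  rational 8/5: \<open>3^5 <= 2^8\<close> gives \<open>ln 3 / ln 2 <= 8/5\<close>, and
  \<open>(7/6)^8 < (4/3)^5\<close> gives \<open>ln (4/3) / ln (7/6) > 8/5\<close>.\<close>

lemma F_2_2_less_F_3_1: "F 2 2 < F 3 1"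
proof -
  have "ln ((3::real) ^ 5) \<le> ln (2 ^ 8)" by (subst ln_le_cancel_iff) auto
  then have 1: "5 * ln 3 \<le> 8 * ln (2::real)" by (simp add: ln_realpow del: power_numeral)
  have "ln ((7/6::real) ^ 8) < ln ((4/3) ^ 5)"
    by (subst ln_less_cancel_iff) (simp_all add: power_divide)
  then have 2: "8 * ln (7/6) < 5 * ln (4/3::real)" by (simp add: ln_realpow del: power_numeral)
  have "5 * ln 3 * ln (7/6) \<le> 8 * ln 2 * ln (7/6::real)"
    using 1 by (intro mult_right_mono) auto
  also have "\<dots> = ln 2 * (8 * ln (7/6))" by simp
  also have "\<dots> < ln 2 * (5 * ln (4/3::real))"
    using 2 by (intro mult_strict_left_mono) auto
  finally have "ln (7/6) / ln 2 < ln (4/3) / ln (3::real)"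
    by (simp add: field_simps)
  then show ?thesis by (simp add: F_def numeral_2_eq_2)
qed

text \<open>Only \<open>F 2 1\<close> exceeds \<open>F 3 1\<close>: monotonicity disposes of
  \<open>p >= 3\<close>, the preceding lemma of \<open>p = 2\<close> with \<open>k >= 2\<close>. But
  \<open>E\<close> has at least two elements at or above \<open>eps i\<close>.\<close>

lemma eps_le_F_3_1:
  assumes "2 \<le> i"
  shows "eps i \<le> F 3 1"
proof (rule ccontr)
  assume "\<not> eps i \<le> F 3 1"
  then have lt: "F 3 1 < eps i" by simp
  have "{x \<in> E. eps i \<le> x} \<subseteq> {F 2 1}"
  proof
    fix x assume "x \<in> {x \<in> E. eps i \<le> x}"
    then obtain p k where pk: "x = F (real p) k" "prime p" "1 \<le> k" "F 3 1 < F (real p) k"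
      using lt by (auto simp: E_def)
    have "\<not> 3 \<le> p"
    proof
      assume "3 \<le> p"
      then have "F (real p) k \<le> F 3 1"
        using F_antimono_exponent[of "real p" 1 k] F_antimono[of 3 "real p" 1] pk by simp
      then show False using pk by simp
    qed
    then have p: "p = 2" using prime_ge_2_nat[OF pk(2)] by simp
    have "\<not> 2 \<le> k"
      using F_antimono_exponent[of 2 2 k] F_2_2_less_F_3_1 pk p by auto
    then show "x \<in> {F 2 1}" using pk p by (simp add: le_Suc_eq numeral_2_eq_2 not_le less_Suc_eq)
  qed
  then have "card {x \<in> E. eps i \<le> x} \<le> 1"
    using card_mono[of "{F 2 1}"] by fastforce
  then show False using eps_spec(2)[of i] assms by simp
qed

section \<open>The sum of divisors\<close>

lemma sigma_pos: "0 < n \<Longrightarrow> 0 < sigma n"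
  by (auto simp: sigma_def intro!: sum_pos intro: dvd_refl)

text \<open>The case of multiplicativity that is needed. The divisors of \<open>q^(b+1) * t\<close>
  are those of \<open>q^b * t\<close> and \<open>q^(b+1)\<close> times those of \<open>t\<close>;
  the union is disjoint because \<open>q\<close> does not divide \<open>t\<close>.\<close>

lemma sigma_prime_power_mult:
  fixes q t :: nat
  assumes "prime q" "\<not> q dvd t"
  shows "sigma (q ^ b * t) = (\<Sum>j\<le>b. q ^ j) * sigma t"
proof (induction b)
  case 0
  then show ?case by simp
next
  case (Suc b)
  have t: "0 < t" using assms by (cases t) auto
  have q: "0 < q" using assms by (simp add: prime_gt_0_nat)
  have eq: "{d. d dvd q ^ Suc b * t} = {d. d dvd q ^ b * t} \<union> (*) (q ^ Suc b) ` {d. d dvd t}"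
  proof (intro equalityI subsetI)
    fix d assume "d \<in> {d. d dvd q ^ Suc b * t}"
    then have d: "d dvd q ^ Suc b * t" by simp
    have "d \<noteq> 0" using d t q by (metis dvd_0_left_iff mult_is_0 neq0_conv power_not_zero)
    \<comment> \<open>Split off the \<open>q\<close>-part of \<open>d\<close>: the cofactor
      \<open>c\<close> is prime to \<open>q\<close>, hence divides \<open>t\<close>, and the
      exponent of \<open>q\<close> decides between the two sets.\<close>
    then obtain c where c: "d = q ^ multiplicity q d * c" "\<not> q dvd c"
      using assms by (metis multiplicity_decompose' not_prime_unit)
    define k where "k = multiplicity q d"
    have kle: "k \<le> Suc b"
    proof -
      have "multiplicity q d \<le> multiplicity q (q ^ Suc b * t)"
        using d t q by (intro dvd_imp_multiplicity_le) auto
      also have "\<dots> = Suc b"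
        using assms t q by (intro multiplicity_eqI) (auto simp: mult_dvd_mono)
      finally show ?thesis by (simp add: k_def)
    qed
    have "coprime c (q ^ Suc b)"
      using c assms by (metis coprime_commute coprime_power_left_iff prime_imp_coprime)
    moreover have "c dvd q ^ Suc b * t" using c d by (metis dvd_mult_right)
    ultimately have ct: "c dvd t" by (simp add: coprime_dvd_mult_right_iff)
    show "d \<in> {d. d dvd q ^ b * t} \<union> (*) (q ^ Suc b) ` {d. d dvd t}"
    proof (cases "k = Suc b")
      case True
      then show ?thesis using c ct by (auto simp: k_def)
    next
      case False
      then have "q ^ k dvd q ^ b" using kle by (intro le_imp_power_dvd) simp
      then have "d dvd q ^ b * t" using c ct by (metis k_def mult_dvd_mono)
      then show ?thesis by simp
    qed
  next
    fix d assume "d \<in> {d. d dvd q ^ b * t} \<union> (*) (q ^ Suc b) ` {d. d dvd t}"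
    then show "d \<in> {d. d dvd q ^ Suc b * t}"
      by (auto intro: mult_dvd_mono dvd_trans[of d "q ^ b * t"])
  qed
  have disj: "{d. d dvd q ^ b * t} \<inter> (*) (q ^ Suc b) ` {d. d dvd t} = {}"
  proof -
    have False if "q ^ Suc b * c dvd q ^ b * t" for c
    proof -
      have "q ^ b * (q * c) dvd q ^ b * t" using that by (simp add: mult.assoc mult.left_commute)
      then have "q * c dvd t" using q by (metis dvd_times_left_cancel_iff power_not_zero neq0_conv)
      then show False using assms by (metis dvd_mult_left)
    qed
    then show ?thesis by blast
  qed
  have "sigma (q ^ Suc b * t) = sigma (q ^ b * t) + (\<Sum>d\<in>(*) (q ^ Suc b) ` {d. d dvd t}. d)"
    unfolding sigma_def eq using disj t q by (intro sum.union_disjoint) auto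
  also have "(\<Sum>d\<in>(*) (q ^ Suc b) ` {d. d dvd t}. d) = q ^ Suc b * sigma t"
    using q by (subst sum.reindex) (auto simp: inj_on_def sigma_def sum_distrib_left)
  finally show ?case using Suc by (simp add: algebra_simps)
qed

text \<open>This is what \<open>F\<close> is made for: with \<open>k = multiplicity q m + 1\<close>
  and \<open>S = q + ... + q^k\<close>, the quotient \<open>rho (m * q) / rho m\<close> is
  \<open>(1 + S) / S\<close>, which is \<open>q powr F q k\<close>.\<close>

lemma rho_mult_prime:
  assumes "prime q" "0 < m"
  shows "rho (m * q) = rho m * exp (F (real q) (multiplicity q m + 1) * ln (real q))"
proof -
  define b where "b = multiplicity q m"
  obtain t where t: "m = q ^ b * t" "\<not> q dvd t"
    using multiplicity_decompose'[of m q] assms not_prime_unit unfolding b_def by (metis neq0_conv)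
  have q: "1 < real q" using assms(1) by (rule prime_gt_1_real)
  define S where "S = (\<Sum>j=1..b + 1. real q ^ j)"
  have S: "0 < S"
    using geometric_sum_ge(1)[of "real q" "b + 1"] q by (simp add: S_def)
  \<comment> \<open>\<open>1 + S\<close> is \<open>sigma (q ^ (b + 1))\<close> and \<open>S\<close>
    is \<open>q * sigma (q ^ b)\<close>; the common factor \<open>sigma t\<close> cancels in the
    quotient.\<close>
  have S1: "(\<Sum>j\<le>b + 1. real q ^ j) = 1 + S"
    unfolding S_def by (simp add: sum.atMost_shift sum.atLeast1_atMost_eq del: sum.atMost_Suc)
  have S2: "S = real q * (\<Sum>j\<le>b. real q ^ j)"
    unfolding S_def by (simp add: sum.atLeast1_atMost_eq sum_distrib_left distrib_left flip: lessThan_Suc_atMost)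
  have "m * q = q ^ (b + 1) * t" using t by simp
  then have "real (sigma (m * q)) = (\<Sum>j\<le>b + 1. real q ^ j) * real (sigma t)"
    using sigma_prime_power_mult[OF assms(1) t(2), of "b + 1"]
    by (simp only: of_nat_mult of_nat_sum of_nat_power)
  then have s1: "real (sigma (m * q)) = (1 + S) * real (sigma t)"
    by (simp only: S1)
  have s2: "real q * real (sigma m) = S * real (sigma t)"
    using sigma_prime_power_mult[OF assms(1) t(2), of b] t S2 by simp
  have "rho (m * q) = (1 + S) * real (sigma t) / (real m * real q)"
    by (simp add: rho_def s1)
  also have "\<dots> = (1 + 1 / S) * (S * real (sigma t)) / (real m * real q)"
    using S by (intro arg_cong2[of _ _ _ _ "(/)"]) (simp_all add: field_simps)
  also have "\<dots> = rho m * (1 + 1 / S)"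
    unfolding s2[symmetric] rho_def using q by simp
  also have "1 + 1 / S = exp (F (real q) (b + 1) * ln (real q))"
    unfolding F_def S_def[symmetric] using q S by (simp add: add_pos_pos)
  finally show ?thesis by (simp add: b_def)
qed

text \<open>Bounding \<open>F\<close> at all larger exponents, not just at the next one, lets the
  hypothesis pass from \<open>m\<close> to its nonzero multiples, as is wanted when two primes are
  gained.\<close>

lemma rho_mult_prime_le:
  assumes "prime q" "0 < m" "\<And>k. multiplicity q m < k \<Longrightarrow> F (real q) k \<le> c"
  shows "rho (m * q) \<le> rho m * exp (c * ln (real q))"
proof -
  have "F (real q) (multiplicity q m + 1) * ln (real q) \<le> c * ln (real q)"
    using assms prime_gt_1_real[of q] by (intro mult_right_mono) auto
  then show ?thesis
    unfolding rho_mult_prime[OF assms(1,2)] by (intro mult_left_mono) (auto simp: rho_def)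
qed

section \<open>Consecutive colossally abundant numbers\<close>

text \<open>An exponent not reached at \<open>eps (i - 1)\<close> has its \<open>F\<close> value
  strictly below \<open>eps (i - 1)\<close>, and \<open>eps i\<close> is the next element of
  \<open>E\<close>.\<close>

lemma F_le_eps_if_gt_multiplicity:
  assumes "2 \<le> i" "prime q" "multiplicity q (ca_number (i - 1)) < k"
  shows "F (real q) k \<le> eps i"
proof (rule le_eps_if_less_eps_pred[OF assms(1)])
  show "F (real q) k \<in> E"
    unfolding E_def using assms by (intro CollectI exI[of _ q] exI[of _ k]) auto
  show "F (real q) k < eps (i - 1)"
    using assms unfolding ca_number_def
    by (intro F_less_if_gt_multiplicity E_pos eps_spec) auto
qed

text \<open>For \<open>i >= 3\<close> this serves both \<open>i\<close> and \<open>i - 1\<close>: it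
  gives \<open>m >= 3\<close>, so that \<open>ln (ln m) > 0\<close>, and \<open>p >= 3\<close>, so
  that \<open>ln p > 1\<close>.\<close>

lemma three_dvd_ca_number:
  assumes "2 \<le> i"
  shows "3 dvd ca_number i"
proof -
  have "prime (3::nat)" by simp
  with dvd_ca_from_iff[of "eps i" 3] show ?thesis
    using eps_le_F_3_1[OF assms] E_pos[OF eps_spec(1)[of i]] assms by (simp add: ca_number_def)
qed

text \<open>Stated for any quotient \<open>d > 1\<close>, so that \<open>d = q\<close> and
  \<open>d = q * r\<close> share one argument; each case supplies its own bound on
  \<open>rho\<close>.\<close>

lemma G_ca_number_less:
  fixes i p :: nat
  assumes i: "3 \<le> i" and CA: "CA1 i" and p: "p = largest_prime_factor (ca_number i)"
    and d: "1 < d" "ca_number i = ca_number (i - 1) * d"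
    and rho: "rho (ca_number i) \<le> rho (ca_number (i - 1)) * exp (eps i * ln (real d))"
  shows "G (ca_number i) < G (ca_number (i - 1)) * (1 - (ln (real d) / (real p * ln (real p)))\<^sup>2)"
proof -
  define n where "n = ca_number i"
  define m where "m = ca_number (i - 1)"
  have pos: "0 < n" "0 < m" by (auto simp: n_def m_def ca_number_def ca_from_pos)
  have e: "0 < eps i" using i by (intro E_pos eps_spec) auto
  have m3: "3 \<le> m"
    using three_dvd_ca_number[of "i - 1"] i pos by (simp add: m_def dvd_imp_le)
  have "3 \<in> prime_factors n"
    using three_dvd_ca_number[of i] i pos by (simp add: n_def prime_factors_dvd)
  then have p3: "3 \<le> p" and "p \<in> prime_factors n"
    unfolding p largest_prime_factor_def n_def[symmetric] by (auto intro!: Max_ge Max_in)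
  then have pp: "prime p" "p dvd n" by auto
  have lnm: "1 < ln (real m)" and lnp: "1 < ln (real p)"
    using m3 p3 by (auto intro!: ln_gt_1_if_ge_3)
  have nm: "ln (real n) - ln (real m) = ln (real d)"
    using d pos by (simp add: n_def m_def ln_mult)
  have lnmn: "ln (real m) < ln (real n)"
  proof -
    have "0 < ln (real d)" using d(1) by (intro ln_gt_zero) simp
    then show ?thesis using nm by linarith
  qed
  \<comment> \<open>The \<open>CA1\<close> condition provides \<open>B < P\<close> for the analytic
    estimate.\<close>
  have lnn: "ln (real n) < real p" using CA by (simp add: CA1_def p n_def)
  define u where "u = ln (real d) / (real p * ln (real p))"
  \<comment> \<open>As \<open>p\<close> divides \<open>n\<close>, \<open>eps i\<close> is at most
    \<open>F p 1\<close>; thus the growth factor of \<open>rho\<close> is at most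
    \<open>exp u\<close>.\<close>
  have "eps i \<le> F (real p) 1"
    using pp dvd_ca_from_iff[OF e pp(1)] by (simp add: n_def ca_number_def)
  also have "\<dots> \<le> 1 / (real p * ln (real p))"
    using p3 by (intro F_le) auto
  finally have "eps i * ln (real d) \<le> 1 / (real p * ln (real p)) * ln (real d)"
    using d by (intro mult_right_mono) auto
  then have eu: "eps i * ln (real d) \<le> u" by (simp add: u_def)
  have rhom: "0 < rho m" using pos sigma_pos[of m] by (simp add: rho_def)
  have lls: "0 < ln (ln (real m))" "0 < ln (ln (real n))"
    using lnm lnmn by auto
  have "rho n \<le> rho m * exp (eps i * ln (real d))"
    using rho by (simp add: n_def m_def)
  also have "\<dots> \<le> rho m * exp u"
    using eu rhom by simp
  finally have "G n \<le> rho m * exp u / ln (ln (real n))"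
    unfolding G_def using lls by (intro divide_right_mono) auto
  also have "\<dots> = G m * (exp u * (ln (ln (real m)) / ln (ln (real n))))"
    using lls by (simp add: G_def)
  also have "\<dots> < G m * (1 - u\<^sup>2)"
  proof (rule mult_strict_left_mono)
    show "exp u * (ln (ln (real m)) / ln (ln (real n))) < 1 - u\<^sup>2"
      using exp_times_ln_ln_ratio_less[OF lnm lnmn lnn lnp] by (simp add: u_def nm)
    show "0 < G m" using rhom lls by (simp add: G_def)
  qed
  finally show ?thesis by (simp add: n_def m_def u_def)
qed

theorem theorem1:
  fixes i p :: nat
  assumes "i \<ge> 3"
    and "CA1 i"
    and "p = largest_prime_factor (ca_number i)"
  shows "(\<forall>q::nat. prime q \<and> real (ca_number i) / real (ca_number (i - 1)) = real q \<longrightarrow>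
            G (ca_number i) < G (ca_number (i - 1)) * (1 - (ln (real q) / (real p * ln (real p)))\<^sup>2))
       \<and> (\<forall>q r::nat. prime q \<and> prime r
              \<and> real (ca_number i) / real (ca_number (i - 1)) = real q * real r \<longrightarrow>
            G (ca_number i) < G (ca_number (i - 1))
              * (1 - (ln (real q) / (real p * ln (real p)))\<^sup>2)
              * (1 - (ln (real r) / (real p * ln (real p)))\<^sup>2))"
proof (intro conjI allI impI; elim conjE)
  define m where "m = ca_number (i - 1)"
  have m: "0 < m" by (simp add: m_def ca_number_def ca_from_pos)
  have F_le_eps: "F (real q) k \<le> eps i" if "prime q" "multiplicity q m < k" for q k
    using F_le_eps_if_gt_multiplicity[of i q k] that assms(1) by (simp add: m_def)
  have factor: "ca_number i = m * d" if "real (ca_number i) / real m = real d" for d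
    using that m by (simp add: field_simps flip: of_nat_mult)
  {
    fix q :: nat
    assume q: "prime q" and "real (ca_number i) / real (ca_number (i - 1)) = real q"
    then have n: "ca_number i = m * q" using factor by (simp add: m_def)
    have "rho (m * q) \<le> rho m * exp (eps i * ln (real q))"
      using q m F_le_eps by (intro rho_mult_prime_le)
    then show "G (ca_number i)
        < G (ca_number (i - 1)) * (1 - (ln (real q) / (real p * ln (real p)))\<^sup>2)"
      using G_ca_number_less[OF assms, of q] n q by (simp add: m_def prime_gt_Suc_0_nat)
  next
    fix q r :: nat
    assume q: "prime q" and r: "prime r"
      and "real (ca_number i) / real (ca_number (i - 1)) = real q * real r"
    then have n: "ca_number i = m * (q * r)" using factor[of "q * r"] by (simp add: m_def)
    have q1: "1 < q" "1 < r" using q r by (simp_all add: prime_gt_Suc_0_nat)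
    \<comment> \<open>This also covers \<open>q = r\<close>: multiplying by \<open>q\<close> never
      lowers the multiplicity of \<open>r\<close>, so the bound on \<open>F\<close> at exponents
      beyond that in \<open>m\<close> still applies.\<close>
    have "multiplicity r m \<le> multiplicity r (m * q)"
      using m q1 by (intro dvd_imp_multiplicity_le) auto
    then have "rho (m * q * r) \<le> rho (m * q) * exp (eps i * ln (real r))"
      using r m q1 F_le_eps by (intro rho_mult_prime_le) auto
    also have "\<dots> \<le> rho m * exp (eps i * ln (real q)) * exp (eps i * ln (real r))"
      using q m F_le_eps by (intro mult_right_mono rho_mult_prime_le) auto
    also have "\<dots> = rho m * exp (eps i * ln (real (q * r)))"
      using q1 by (simp add: ln_mult algebra_simps exp_add)
    finally have rho: "rho (m * (q * r)) \<le> rho m * exp (eps i * ln (real (q * r)))"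
      by (simp add: mult.assoc)
    have qr: "1 < q * r" using q1 by (rule less_1_mult)
    \<comment> \<open>For \<open>d = q * r\<close> the \<open>u\<close> of the general estimate is
      \<open>s + t\<close>.\<close>
    define s where "s = ln (real q) / (real p * ln (real p))"
    define t where "t = ln (real r) / (real p * ln (real p))"
    have st: "ln (real (q * r)) / (real p * ln (real p)) = s + t"
      using q1 by (simp add: s_def t_def ln_mult add_divide_distrib)
    \<comment> \<open>Holds for every natural \<open>p\<close>, by the convention
      \<open>ln 0 = 0\<close> in the case \<open>p = 0\<close>.\<close>
    have "0 \<le> ln (real p)" by (cases "p = 0") auto
    then have "0 \<le> s" "0 \<le> t" using q1 by (auto simp: s_def t_def)
    then have "0 \<le> (s * t)\<^sup>2 + 2 * (s * t)" by simp
    also have "\<dots> = (1 - s\<^sup>2) * (1 - t\<^sup>2) - (1 - (s + t)\<^sup>2)"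
      by (simp add: power2_eq_square algebra_simps)
    finally have "1 - (s + t)\<^sup>2 \<le> (1 - s\<^sup>2) * (1 - t\<^sup>2)"
      by simp
    moreover have "0 \<le> G m"
    proof -
      have "3 \<le> m"
        using three_dvd_ca_number[of "i - 1"] assms(1) m by (simp add: m_def dvd_imp_le)
      then have "1 < ln (real m)" by (intro ln_gt_1_if_ge_3) simp
      then show ?thesis by (simp add: G_def rho_def)
    qed
    ultimately have "G m * (1 - (s + t)\<^sup>2) \<le> G m * ((1 - s\<^sup>2) * (1 - t\<^sup>2))"
      by (rule mult_left_mono)
    moreover have "G (ca_number i) < G m * (1 - (s + t)\<^sup>2)"
      using G_ca_number_less[OF assms qr] n rho by (simp only: m_def st)
    ultimately show "G (ca_number i) < G (ca_number (i - 1))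
        * (1 - (ln (real q) / (real p * ln (real p)))\<^sup>2)
        * (1 - (ln (real r) / (real p * ln (real p)))\<^sup>2)"
      by (simp add: m_def s_def t_def mult.assoc)
  }
qed

end
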